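(* Let $n\ge 3$. For every $Z\in\mathbb{M}(n)$ there are $n=\dim\mathbb{M}(n)$ (pairwise) orthogonal straight lines contained in the intersection $\mathbb{M}(n)\cap T_Z\mathbb{M}(n)$. Furthermore, there are subsets of $\mathbb{M}(n)\cap T_Z\mathbb{M}(n)$ isometric to $\mathbb{R}^{n-1}\smallsetminus\{\vec 0\}$ and to $\mathbb{R}^2\smallsetminus\{\vec 0\}$, respectively.
   Context: Let $n\ge 3$ and $\mathcal{D}_n=\{(b,\dots,b)\in\mathbb{C}^n : b\in\mathbb{C}\}$. $\mathbb{L}(n)\subset\mathbb{C}^n$ is the set of $n$-segments: points $(z_1,\dots,z_n)\in\mathbb{C}^n\smallsetminus\mathcal{D}_n$ such that $z_1,\dots,z_n$ lie on a common real straight line in $\mathbb{C}$. Let $V_n=\{(0,z_2,\dots,z_n)\in\mathbb{C}^n\}$ and $\mathbb{M}(n)=\mathbb{L}(n)\cap V_n$; equivalently, $\mathbb{M}(n)=\{aX : a\in\mathbb{C}\smallsetminus\{0\},\ X\in (V_n\cap\mathbb{R}^n)\smallsetminus\{\vec 0\}\}$, a smooth real $n$-dimensional submanifold of $\mathbb{C}^n$. Here $T_Z\mathbb{M}(n)$ denotes the affine tangent space, i.e. the translate $Z+\{\alpha'(0)\}$ where $\alpha$ ranges over differentiable curves in $\mathbb{M}(n)$ with $\alpha(0)=Z$. $\mathbb{C}^n\cong\mathbb{R}^{2n}$ carries the Euclidean inner product $\langle\!\langle Z,W\rangle\!\rangle=\sum_j \mathrm{Re}(z_j\overline{w_j})$;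 straight lines are full real affine lines $\{P+tv : t\in\mathbb{R}\}$, $v\neq 0$, in $\mathbb{C}^n$; lines are orthogonal when their direction vectors are; isometry is with respect to the Euclidean distances. *)

theory Defs
  imports "HOL-Analysis.Analysis"
begin

text \<open>
  The space \<open>\<complex>\<^sup>n\<close> is \<open>complex ^ 'n\<close>, where \<open>'n\<close> is a finite linearly ordered index type
  with \<open>CARD('n) = n\<close>; the first coordinate is the one at \<open>Min UNIV\<close>. The library inner product
  on \<open>complex ^ 'n\<close> is the real one, the sum of the \<open>Re (z\<^sub>j * cnj w\<^sub>j)\<close>, and \<open>dist\<close> is the
  corresponding Euclidean distance.
\<close>

definition line_through :: "'a::real_vector \<Rightarrow> 'a \<Rightarrow> 'a set" where
  "line_through P v = {P + t *\<^sub>R v | t. t \<in> (UNIV :: real set)}"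

definition straight_line :: "'a::real_vector set \<Rightarrow> bool" where
  "straight_line L \<longleftrightarrow> (\<exists>P v. v \<noteq> 0 \<and> L = line_through P v)"

text \<open>Orthogonal lines are not required to meet.\<close>

definition orthogonal_lines :: "'a::real_inner set \<Rightarrow> 'a set \<Rightarrow> bool" where
  "orthogonal_lines L L' \<longleftrightarrow>
     (\<exists>P v P' v'. v \<noteq> 0 \<and> v' \<noteq> 0 \<and> L = line_through P v \<and> L' = line_through P' v'
        \<and> orthogonal v v')"

definition isometric_sets :: "'a::metric_space set \<Rightarrow> 'b::metric_space set \<Rightarrow> bool" where
  "isometric_sets A B \<longleftrightarrow>
     (\<exists>f. f ` A = B \<and> (\<forall>x\<in>A. \<forall>y\<in>A. dist (f x) (f y) = dist x y))"

definition diag_points :: "(complex ^ 'n) set" where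
  "diag_points = {z. \<exists>b. \<forall>j. z $ j = b}"

definition n_segments :: "(complex ^ 'n) set" where
  "n_segments = {z. z \<notin> diag_points \<and> (\<exists>L. straight_line L \<and> (\<forall>j. z $ j \<in> L))}"

definition first_zero :: "(complex ^ 'n::{finite,linorder}) set" where
  "first_zero = {z. z $ Min UNIV = 0}"

definition segments_M :: "(complex ^ 'n::{finite,linorder}) set" where
  "segments_M = n_segments \<inter> first_zero"

text \<open>
  Curves are total functions of which only the restriction to some open interval around \<open>0\<close>
  matters.
\<close>

definition affine_tangent_space :: "'a::real_normed_vector set \<Rightarrow> 'a \<Rightarrow> 'a set" where
  "affine_tangent_space M Z =
     {Z + v | v. \<exists>\<alpha> e. e > 0 \<and> \<alpha> ` {-e<..<e} \<subseteq> M \<and> \<alpha> differentiable_on {-e<..<e}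
                   \<and> \<alpha> 0 = Z \<and> (\<alpha> has_vector_derivative v) (at (0::real))}"

end

theory Submission imports Defs begin

text \<open>
  A point of \<open>\<M>(n)\<close> is \<open>aX\<close> with \<open>\<bar>a\<bar> = 1\<close> and \<open>X \<noteq> 0\<close> a real vector of \<open>V\<^sub>n\<close>. As \<open>\<M>(n)\<close> lies in
  the zero set of the quadratic forms \<open>Im (z\<^sub>j * cnj z\<^sub>k)\<close>, differentiating these along curves
  shows that the tangent space at \<open>aX\<close> is \<open>{aY + s \<i> a X}\<close> with \<open>Y \<in> V\<^sub>n\<close> real and \<open>s\<close> real,
  which already contains the base point. It has the orthogonal basis \<open>\<i>aX, ae\<^sub>2, \<dots>, ae\<^sub>n\<close>.
  Its intersection with \<open>\<M>(n)\<close> contains the punctured space \<open>a(V\<^sub>n \<inter> \<real>\<^sup>n) - {0}\<close> and the punctured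
  plane \<open>\<complex>X - {0}\<close>. The lines through \<open>aX\<close> in
  direction \<open>\<i>aX\<close> and through \<open>ae\<^sub>k\<close> in direction \<open>ae\<^sub>j\<close>, \<open>k \<noteq> j\<close>, avoid the origin.
\<close>

section \<open>Real vectors scaled by a complex number\<close>

definition cscale :: "complex \<Rightarrow> real ^ 'n \<Rightarrow> complex ^ 'n" where
  "cscale a x = (\<chi> j. a * of_real (x $ j))"

lemma cscale_nth [simp]: "cscale a x $ j = a * of_real (x $ j)"
  by (simp add: cscale_def)

lemma inner_cscale: "inner (cscale a x) (cscale b y) = Re (a * cnj b) * inner x y"
  by (simp add: inner_vec_def inner_complex_def sum_distrib_left sum.distrib[symmetric] algebra_simps)

text \<open>For \<open>norm a = 1\<close> this makes \<open>cscale a\<close> norm-preserving, hence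
  an isometric embedding of real space.\<close>

lemma norm_cscale: "norm (cscale a x) = norm a * norm x"
proof -
  have "Re (a * cnj a) = (norm a)\<^sup>2"
    by (simp add: cmod_power2) (simp add: power2_eq_square)
  then show ?thesis
    by (simp add: norm_eq_sqrt_inner[of "cscale a x"] norm_eq_sqrt_inner[of x]
        inner_cscale real_sqrt_mult)
qed

text \<open>Besides linearity in each argument, this gives the product rule for curves in which the
  scalar and the real vector both move.\<close>

lemma bounded_bilinear_cscale: "bounded_bilinear (cscale :: complex \<Rightarrow> real ^ 'n \<Rightarrow> _)"
proof
  show "\<exists>K. \<forall>a (b :: real ^ 'n). norm (cscale a b) \<le> norm a * norm b * K"
    by (intro exI[of _ 1]) (simp add: norm_cscale)
qed (simp_all add: vec_eq_iff algebra_simps scaleR_conv_of_real[where 'a=complex])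

interpretation cscale: bounded_bilinear "cscale :: complex \<Rightarrow> real ^ 'n \<Rightarrow> complex ^ 'n"
  by (rule bounded_bilinear_cscale)

lemma cscale_eq_0_iff: "cscale a x = 0 \<longleftrightarrow> a = 0 \<or> x = 0"
  by (metis norm_cscale norm_eq_zero mult_eq_0_iff)

lemma cscale_axis_expansion: "cscale a y = (\<Sum>j\<in>UNIV. y $ j *\<^sub>R cscale a (axis j 1))"
proof -
  have "cscale a (\<Sum>j\<in>UNIV. y $ j *\<^sub>R axis j 1) = (\<Sum>j\<in>UNIV. y $ j *\<^sub>R cscale a (axis j 1))"
    by (simp add: cscale.sum_right cscale.scaleR_right)
  moreover have "(\<Sum>j\<in>UNIV. y $ j *\<^sub>R axis j (1::real)) = y"
    using basis_expansion[of y] by (simp add: scalar_mult_eq_scaleR)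
  ultimately show ?thesis by simp
qed

section \<open>Points of M(n) as rotated real vectors\<close>

lemma cscale_in_segments_M:
  fixes x :: "real ^ 'n::{finite,linorder}"
  assumes "a \<noteq> 0" "x $ Min UNIV = 0" "x \<noteq> 0"
  shows "cscale a x \<in> segments_M"
proof -
  have "cscale a x \<notin> diag_points"
  proof
    assume "cscale a x \<in> diag_points"
    then obtain b where "\<And>j. cscale a x $ j = b"
      unfolding diag_points_def by blast
    then have "cscale a x $ j = cscale a x $ Min UNIV" for j by metis
    then have "x $ j = 0" for j using assms by simp
    then have "x = 0" by (simp add: vec_eq_iff)
    with assms show False by simp
  qed
  moreover have "\<exists>L. straight_line L \<and> (\<forall>j. cscale a x $ j \<in> L)"
  proof (intro exI conjI allI)
    show "straight_line (line_through 0 a)"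
      using assms by (auto simp: straight_line_def)
    show "cscale a x $ j \<in> line_through 0 a" for j
      by (auto simp: line_through_def scaleR_conv_of_real[where 'a=complex] mult.commute)
  qed
  ultimately show ?thesis
    using assms by (auto simp: segments_M_def n_segments_def first_zero_def)
qed

text \<open>Since one coordinate is 0, the line carrying all coordinates passes through 0, so each
  of them is a real multiple of its direction.\<close>

lemma segments_M_cases:
  fixes z :: "complex ^ 'n::{finite,linorder}"
  assumes "z \<in> segments_M"
  obtains a x where "norm a = 1" "x $ Min UNIV = 0" "x \<noteq> 0" "z = cscale a x"
proof -
  have z0: "z $ Min UNIV = 0" and nd: "z \<notin> diag_points"
    using assms by (auto simp: segments_M_def n_segments_def first_zero_def)
  obtain P v where v: "v \<noteq> 0" and "\<forall>j. z $ j \<in> line_through P v"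
    using assms by (auto simp: segments_M_def n_segments_def straight_line_def)
  then have "\<forall>j. \<exists>t. z $ j = P + t *\<^sub>R v" by (auto simp: line_through_def)
  then obtain t where t: "\<And>j. z $ j = P + t j *\<^sub>R v" by metis
  have P: "P = - t (Min UNIV) *\<^sub>R v" using t[of "Min UNIV"] z0 by (simp add: eq_neg_iff_add_eq_0)
  \<comment> \<open>Parameters are measured from that of the zero coordinate; the factor
    \<open>norm v\<close> compensates for replacing \<open>v\<close> by the unit number
    \<open>sgn v\<close>.\<close>
  define x where "x = (\<chi> j. (t j - t (Min UNIV)) * norm v)"
  have zx: "z = cscale (sgn v) x"
    using v by (simp add: vec_eq_iff t x_def P sgn_eq scaleR_conv_of_real[where 'a=complex] algebra_simps)
  moreover have "x \<noteq> 0"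
    using nd unfolding zx by (auto simp: diag_points_def)
  moreover have "x $ Min UNIV = 0" by (simp add: x_def)
  moreover have "norm (sgn v) = 1" using v by (simp add: norm_sgn)
  ultimately show ?thesis using that by blast
qed

text \<open>For z = aX the product of z_j and the conjugate of z_k is |a|^2 x_j x_k. These are
  equations that can be differentiated along a curve.\<close>

lemma segments_M_collinear:
  assumes "z \<in> segments_M"
  shows "Im (z $ j * cnj (z $ k)) = 0"
proof -
  obtain a x where "z = cscale a x" using segments_M_cases[OF assms] by metis
  then show ?thesis by (simp add: algebra_simps)
qed

text \<open>Differentiated equations bound the tangent space from above; an explicit curve, rotating
  \<open>a\<close> while \<open>x\<close> moves linearly, realises every candidate vector.\<close>

lemma affine_tangent_space_segments_M:
  fixes x :: "real ^ 'n::{finite,linorder}"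
  assumes a: "norm a = 1" and x0: "x $ Min UNIV = 0" and x: "x \<noteq> 0"
  shows "affine_tangent_space segments_M (cscale a x) =
    {cscale a y + s *\<^sub>R cscale (\<i> * a) x | y s. y $ Min UNIV = 0}" (is "?A = ?T")
proof (rule set_eqI)
  have aa: "cnj a * a = 1" using a
    by (metis complex_norm_square mult.commute of_real_1 power_one)
  fix w
  show "w \<in> ?A \<longleftrightarrow> w \<in> ?T"
  proof
    assume "w \<in> ?A"
    then obtain v \<alpha> e where w: "w = cscale a x + v" and e: "e > 0"
      and \<alpha>M: "\<alpha> ` {-e<..<e} \<subseteq> segments_M" and \<alpha>0: "\<alpha> 0 = cscale a x"
      and d: "(\<alpha> has_vector_derivative v) (at (0::real))"
      by (auto simp: affine_tangent_space_def)
    have dj: "((\<lambda>t. \<alpha> t $ j) has_vector_derivative v $ j) (at 0)" for j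
      using bounded_linear.has_vector_derivative[OF bounded_linear_vec_nth d] by simp
    have zero_deriv: "D = 0" if "(g has_vector_derivative D) (at 0)"
        and "\<And>t. t \<in> {-e<..<e} \<Longrightarrow> g t = 0" for g :: "real \<Rightarrow> 'c::real_normed_vector" and D
    proof -
      have "((\<lambda>_. 0) has_vector_derivative D) (at 0)"
        using has_vector_derivative_transform_within_open[OF that(1), of "{-e<..<e}" "\<lambda>_. 0"]
          e that(2) by auto
      then show ?thesis
        using vector_derivative_unique_at has_vector_derivative_const by blast
    qed
    have v0: "v $ Min UNIV = 0"
    proof (rule zero_deriv[OF dj])
      show "\<alpha> t $ Min UNIV = 0" if "t \<in> {-e<..<e}" for t
      proof -
        have "\<alpha> t \<in> first_zero" using \<alpha>M that unfolding segments_M_def by blast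
        then show ?thesis by (simp add: first_zero_def)
      qed
    qed
    \<comment> \<open>A nonzero coordinate of \<open>x\<close> serves as pivot: the forms pairing
      \<open>k\<close> with every \<open>j\<close> already determine the tangent directions.\<close>
    obtain k where k: "x $ k \<noteq> 0" using x by (auto simp: vec_eq_iff)
    have Im0: "Im (v $ j * cnj (cscale a x $ k) + cscale a x $ j * cnj (v $ k)) = 0" for j
    proof (rule zero_deriv)
      have "((\<lambda>t. \<alpha> t $ j * cnj (\<alpha> t $ k)) has_vector_derivative
          \<alpha> 0 $ j * cnj (v $ k) + v $ j * cnj (\<alpha> 0 $ k)) (at 0)"
        by (intro has_vector_derivative_mult dj has_vector_derivative_cnj)
      then show "((\<lambda>t. Im (\<alpha> t $ j * cnj (\<alpha> t $ k))) has_vector_derivative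
          Im (v $ j * cnj (cscale a x $ k) + cscale a x $ j * cnj (v $ k))) (at 0)"
        using bounded_linear.has_vector_derivative[OF bounded_linear_Im] \<alpha>0
        by (fastforce simp: add.commute)
      show "Im (\<alpha> t $ j * cnj (\<alpha> t $ k)) = 0" if "t \<in> {-e<..<e}" for t
        using segments_M_collinear \<alpha>M that by blast
    qed
    \<comment> \<open>Rotating back by \<open>cnj a\<close>, the inverse of \<open>a\<close>,
      separates motion within the real vectors (real part) from rotation of \<open>a\<close>
      (imaginary part).\<close>
    define u where "u j = cnj a * v $ j" for j
    have v_eq: "v $ j = a * u j" for j
      using aa by (simp add: u_def mult.assoc[symmetric] mult.commute)
    \<comment> \<open>The differentiated equation reads Im(u_j) x_k = x_j Im(u_k), so the imaginary
      part of \<open>u\<close> is a real multiple of \<open>x\<close>.\<close>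
    have Im_u: "Im (u j) = x $ j * (Im (u k) / x $ k)" for j
    proof -
      have "v $ j * cnj (cscale a x $ k) + cscale a x $ j * cnj (v $ k)
          = (cnj a * a) * (u j * of_real (x $ k) + of_real (x $ j) * cnj (u k))"
        by (simp add: v_eq algebra_simps)
      then have "Im (u j * of_real (x $ k) + of_real (x $ j) * cnj (u k)) = 0"
        using Im0[of j] aa by simp
      then show ?thesis using k by (simp add: field_simps)
    qed
    define y where "y = (\<chi> j. x $ j + Re (u j))"
    have "w = cscale a y + (Im (u k) / x $ k) *\<^sub>R cscale (\<i> * a) x"
    proof (rule vec_eq_iff[THEN iffD2], rule allI)
      fix j
      have "u j = of_real (Re (u j)) + \<i> * of_real (x $ j * (Im (u k) / x $ k))"
        by (metis Im_u complex_eq)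
      then have "a * u j = a * (of_real (Re (u j)) + \<i> * of_real (x $ j * (Im (u k) / x $ k)))"
        by simp
      then show "w $ j = (cscale a y + (Im (u k) / x $ k) *\<^sub>R cscale (\<i> * a) x) $ j"
        by (simp add: w v_eq y_def scaleR_conv_of_real[where 'a=complex] algebra_simps)
    qed
    moreover have "y $ Min UNIV = 0"
      using x0 v0 by (simp add: y_def u_def)
    ultimately show "w \<in> ?T" by blast
  next
    assume "w \<in> ?T"
    then obtain y s where y: "y $ Min UNIV = 0"
      and w: "w = cscale a y + s *\<^sub>R cscale (\<i> * a) x" by blast
    define y' where "y' = y - x"
    \<comment> \<open>The factor \<open>a\<close> turns with angular speed \<open>s\<close> while
      \<open>x\<close> heads for \<open>y\<close>; the velocity at 0 is a(y - x) + s \<i> a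
      x.\<close>
    define \<alpha> where "\<alpha> t = cscale (exp (t *\<^sub>R (\<i> * of_real s)) * a) (x + t *\<^sub>R y')" for t :: real
    define \<alpha>' where "\<alpha>' t = cscale (exp (t *\<^sub>R (\<i> * of_real s)) * a) y' +
        cscale (exp (t *\<^sub>R (\<i> * of_real s)) * (\<i> * of_real s) * a) (x + t *\<^sub>R y')" for t :: real
    have d: "(\<alpha> has_vector_derivative \<alpha>' t) (at t)" for t
      unfolding \<alpha>_def \<alpha>'_def
    proof (rule cscale.has_vector_derivative)
      show "((\<lambda>t. exp (t *\<^sub>R (\<i> * of_real s)) * a) has_vector_derivative
          exp (t *\<^sub>R (\<i> * of_real s)) * (\<i> * of_real s) * a) (at t)"
        by (intro has_vector_derivative_mult_left exp_scaleR_has_vector_derivative_right)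
      show "((\<lambda>t. x + t *\<^sub>R y') has_vector_derivative y') (at t)"
        by (auto intro!: derivative_eq_intros)
    qed
    \<comment> \<open>The real vector must stay nonzero for the curve to remain in
      \<open>segments_M\<close>; continuity gives this on a small interval.\<close>
    have "\<forall>\<^sub>F t in at 0. x + t *\<^sub>R y' \<noteq> 0"
    proof (rule tendsto_imp_eventually_ne)
      show "((\<lambda>t::real. x + t *\<^sub>R y') \<longlongrightarrow> x) (at 0)"
        by (auto intro!: tendsto_eq_intros)
    qed (fact x)
    then obtain e where e: "e > 0" and ne0: "\<And>t. t \<noteq> 0 \<Longrightarrow> \<bar>t\<bar> < e \<Longrightarrow> x + t *\<^sub>R y' \<noteq> 0"
      by (auto simp: eventually_at dist_real_def)
    have ne: "x + t *\<^sub>R y' \<noteq> 0" if "t \<in> {-e<..<e}" for t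
      using ne0[of t] x that by (cases "t = 0") (auto simp: abs_less_iff)
    have "\<alpha> ` {-e<..<e} \<subseteq> segments_M"
      using a ne x0 y by (auto simp: \<alpha>_def y'_def intro!: cscale_in_segments_M)
    moreover have "\<alpha> differentiable_on {-e<..<e}"
      using d by (meson differentiableI_vector differentiable_at_withinI differentiable_on_def)
    moreover have "\<alpha> 0 = cscale a x" by (simp add: \<alpha>_def)
    ultimately have "cscale a x + \<alpha>' 0 \<in> ?A"
      using e d[of 0] unfolding affine_tangent_space_def by blast
    moreover have "cscale a x + \<alpha>' 0 = w"
      by (simp add: w \<alpha>'_def y'_def vec_eq_iff scaleR_conv_of_real[where 'a=complex] algebra_simps)
    ultimately show "w \<in> ?A" by simp
  qed
qed

text \<open>Equal lines have parallel directions, and nonzero parallel vectors are not orthogonal.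
  This ensures that the family of lines really has n members.\<close>

lemma orthogonal_lines_neq:
  assumes "v \<noteq> 0" "v' \<noteq> 0" "orthogonal v v'"
  shows "line_through P v \<noteq> line_through P' v'"
proof
  assume eq: "line_through P v = line_through P' v'"
  have "P + 0 *\<^sub>R v \<in> line_through P' v'" "P + 1 *\<^sub>R v \<in> line_through P' v'"
    unfolding eq[symmetric] unfolding line_through_def by blast+
  then obtain r s where "P + 0 *\<^sub>R v = P' + r *\<^sub>R v'" "P + 1 *\<^sub>R v = P' + s *\<^sub>R v'"
    unfolding line_through_def by blast
  then have "v = (s - r) *\<^sub>R v'" by (simp add: algebra_simps)
  with assms show False by (auto simp: orthogonal_def)
qed

lemma isometric_punctured_spaceI:
  fixes g :: "'a::real_normed_vector \<Rightarrow> 'b::real_normed_vector"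
  assumes "linear g" "\<And>y. norm (g y) = norm y" "g ` (UNIV - {0}) \<subseteq> A"
  shows "\<exists>S\<subseteq>A. isometric_sets S (UNIV - {0 :: 'a})"
proof -
  have dist: "dist (g x) (g y) = dist x y" for x y
    by (metis assms(1,2) dist_norm linear_diff)
  then have "inj g" by (metis dist_eq_0_iff injI)
  \<comment> \<open>\<open>isometric_sets\<close> asks for a map out of the subset of
    \<open>A\<close>, so the inverse of \<open>g\<close> is the witness.\<close>
  then have img: "inv g ` g ` (UNIV - {0}) = UNIV - {0}"
    by (simp add: image_comp)
  have dist_inv: "dist (inv g u) (inv g v) = dist u v"
    if "u \<in> g ` (UNIV - {0})" "v \<in> g ` (UNIV - {0})" for u v
    using that \<open>inj g\<close> dist by auto
  have "isometric_sets (g ` (UNIV - {0})) (UNIV - {0 :: 'a})"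
    unfolding isometric_sets_def by (intro exI[of _ "inv g"] conjI img ballI dist_inv)
  with assms(3) show ?thesis by blast
qed

theorem theorem3p5:
  fixes Z :: "complex ^ 'n::{finite,linorder}"
  assumes "CARD('n) \<ge> 3"
    and "CARD('m::finite) = CARD('n) - 1"
    and "Z \<in> segments_M"
  shows "aff_dim (affine_tangent_space segments_M Z) = int CARD('n)
    \<and> (\<exists>\<L>. card \<L> = CARD('n)
          \<and> (\<forall>L\<in>\<L>. straight_line L \<and> L \<subseteq> segments_M \<inter> affine_tangent_space segments_M Z)
          \<and> pairwise orthogonal_lines \<L>)
    \<and> (\<exists>S \<subseteq> segments_M \<inter> affine_tangent_space segments_M Z.
          isometric_sets S (UNIV - {0 :: real ^ 'm}))
    \<and> (\<exists>S \<subseteq> segments_M \<inter> affine_tangent_space segments_M Z.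
          isometric_sets S (UNIV - {0 :: real ^ 2}))"
proof -
  define o1 :: 'n where "o1 = Min UNIV"
  obtain a x where a: "norm a = 1" and x0: "x $ o1 = 0" and x: "x \<noteq> 0" and Z: "Z = cscale a x"
    using segments_M_cases[OF assms(3)] unfolding o1_def by blast
  have a0: "a \<noteq> 0" using a by auto
  define T where "T = affine_tangent_space segments_M Z"
  have T: "T = {cscale a y + s *\<^sub>R cscale (\<i> * a) x | y s. y $ o1 = 0}"
    unfolding T_def Z o1_def by (rule affine_tangent_space_segments_M[OF a x0[unfolded o1_def] x])
  have inT: "cscale a y + s *\<^sub>R cscale (\<i> * a) x \<in> T" if "y $ o1 = 0" for y s
    using that unfolding T by blast
  have realM: "cscale a y \<in> segments_M \<inter> T" if "y $ o1 = 0" "y \<noteq> 0" for y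
    using that inT[of y 0] a0 cscale_in_segments_M[of a y] by (simp add: o1_def)
  \<comment> \<open>Splitting p + \<i>q shows that every complex multiple of the base point is a
    real part plus a rotational part, hence lies in \<open>T\<close>.\<close>
  have planeT: "cscale (Complex p q * a) x = cscale a (p *\<^sub>R x) + q *\<^sub>R cscale (\<i> * a) x" for p q
    by (simp add: vec_eq_iff Complex_eq scaleR_conv_of_real[where 'a=complex] algebra_simps)
  have planeM: "cscale (Complex p q * a) x \<in> segments_M \<inter> T" if "p \<noteq> 0 \<or> q \<noteq> 0" for p q
  proof
    show "cscale (Complex p q * a) x \<in> segments_M"
    proof (rule cscale_in_segments_M)
      have "Complex p q \<noteq> 0" using that by (auto simp: complex_eq_iff)
      then show "Complex p q * a \<noteq> 0" using a0 by simp
    qed (use x x0 o1_def in auto)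
    show "cscale (Complex p q * a) x \<in> T"
      unfolding planeT using x0 by (intro inT) simp
  qed

  \<comment> \<open>An orthogonal basis of the tangent space\<close>
  define d where "d j = (if j = o1 then cscale (\<i> * a) x else cscale a (axis j 1))" for j
  have d_ne: "d j \<noteq> 0" for j
    using a0 x by (simp add: d_def cscale_eq_0_iff axis_eq_0_iff)
  \<comment> \<open>The vector \<i>aX is orthogonal to every a e_j because Re(\<i> a cnj a) =
    0.\<close>
  have d_orth: "orthogonal (d i) (d j)" if "i \<noteq> j" for i j
    using that unfolding d_def orthogonal_def
    by (auto simp: inner_cscale inner_axis_axis algebra_simps)
  have inj_d: "inj d"
  proof (rule injI, rule ccontr)
    fix i j assume "d i = d j" "i \<noteq> j"
    then show False using d_orth[of i j] d_ne[of j] by (simp add: orthogonal_self)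
  qed

  \<comment> \<open>The base point is itself a tangent direction, so the translate passes through 0
    and its affine dimension is its linear one.\<close>
  have "subspace T"
    unfolding subspace_def
  proof (intro conjI ballI allI)
    show "0 \<in> T" using inT[of 0 0] by (simp add: cscale.zero_right)
    show "u + v \<in> T" if uv: "u \<in> T" "v \<in> T" for u v
    proof -
      obtain y s y' s' where "y $ o1 = 0" "y' $ o1 = 0"
        and "u = cscale a y + s *\<^sub>R cscale (\<i> * a) x" "v = cscale a y' + s' *\<^sub>R cscale (\<i> * a) x"
        using uv unfolding T by blast
      then show ?thesis
        using inT[of "y + y'" "s + s'"] by (simp add: cscale.add_right algebra_simps)
    qed
    show "c *\<^sub>R u \<in> T" if "u \<in> T" for c u
    proof -
      obtain y s where "y $ o1 = 0" "u = cscale a y + s *\<^sub>R cscale (\<i> * a) x"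
        using \<open>u \<in> T\<close> unfolding T by blast
      then show ?thesis
        using inT[of "c *\<^sub>R y" "c * s"] by (simp add: cscale.scaleR_right algebra_simps)
    qed
  qed
  moreover have "dim T = CARD('n)"
  proof (rule dim_unique)
    show "range d \<subseteq> T"
    proof (intro image_subsetI)
      fix j
      show "d j \<in> T"
        using inT[of 0 1] inT[of "axis j 1" 0] by (auto simp: d_def cscale.zero_right axis_def)
    qed
    show "independent (range d)"
    proof (rule pairwise_orthogonal_independent)
      show "pairwise orthogonal (range d)"
        unfolding pairwise_def using d_orth by (metis imageE)
      show "0 \<notin> range d" using d_ne by (metis imageE)
    qed
    show "T \<subseteq> span (range d)"
    proof
      fix u assume "u \<in> T"
      then obtain y s where y: "y $ o1 = 0" and u: "u = cscale a y + s *\<^sub>R d o1"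
        unfolding T d_def by auto
      have "cscale a y \<in> span (range d)"
      proof (subst cscale_axis_expansion, rule span_sum)
        fix j
        show "y $ j *\<^sub>R cscale a (axis j 1) \<in> span (range d)"
        proof (cases "j = o1")
          case True
          then show ?thesis using y by (simp add: span_zero)
        next
          case False
          then have "cscale a (axis j 1) = d j" by (simp add: d_def)
          then show ?thesis by (simp add: span_base span_scale)
        qed
      qed
      then show "u \<in> span (range d)"
        unfolding u by (intro span_add span_scale) (auto intro: span_base)
    qed
    show "card (range d) = CARD('n)" using inj_d by (rule card_image)
  qed
  ultimately have aff: "aff_dim T = int CARD('n)" by (simp add: aff_dim_subspace)

  \<comment> \<open>The n orthogonal lines\<close>
  have "\<exists>k. k \<noteq> j \<and> k \<noteq> o1" for j
  proof (rule ccontr)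
    assume "\<not> ?thesis"
    then have "UNIV \<subseteq> {j, o1}" by auto
    then have "CARD('n) \<le> card {j, o1}" by (intro card_mono) auto
    also have "\<dots> \<le> 2" by (simp add: card_insert_le_m1)
    finally show False using assms(1) by simp
  qed
  \<comment> \<open>For \<open>j \<noteq> o1\<close> the index \<open>k j\<close> carries the base
    point of the line in direction \<open>d j\<close>; that it can avoid both \<open>j\<close> and
    \<open>o1\<close> uses n \<ge> 3.\<close>
  then obtain k where k: "\<And>j. k j \<noteq> j" "\<And>j. k j \<noteq> o1" by metis
  define p where "p j = (if j = o1 then cscale a x else cscale a (axis (k j) 1))" for j
  define l where "l j = line_through (p j) (d j)" for j
  have orth_l: "orthogonal_lines (l i) (l j)" and neq_l: "l i \<noteq> l j" if "i \<noteq> j" for i j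
    using d_ne d_orth[OF that] orthogonal_lines_neq
    unfolding l_def orthogonal_lines_def by blast+
  have l_sub: "l j \<subseteq> segments_M \<inter> T" for j
  proof
    fix u assume "u \<in> l j"
    then obtain t where t: "u = p j + t *\<^sub>R d j" by (auto simp: l_def line_through_def)
    show "u \<in> segments_M \<inter> T"
    proof (cases "j = o1")
      case True
      \<comment> \<open>The scalar 1 + \<i>t never vanishes, so the whole line stays in the
        punctured plane.\<close>
      then have "u = cscale (Complex 1 t * a) x"
        unfolding planeT by (simp add: t p_def d_def)
      then show ?thesis using planeM by simp
    next
      case False
      define y :: "(real, 'n) vec" where "y = axis (k j) 1 + t *\<^sub>R axis j 1"
      have "u = cscale a y"
        using False by (simp add: t p_def d_def y_def cscale.add_right cscale.scaleR_right)
      moreover have "y $ o1 = 0" using False k[of j] by (simp add: y_def axis_def)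
      \<comment> \<open>This coordinate is constant along the line, which therefore misses the
        origin.\<close>
      moreover have "y $ k j = 1" using k[of j] by (simp add: y_def axis_def)
      then have "y \<noteq> 0" by auto
      ultimately show ?thesis using realM by simp
    qed
  qed
  have lines: "\<exists>\<L>. card \<L> = CARD('n) \<and> (\<forall>L\<in>\<L>. straight_line L \<and> L \<subseteq> segments_M \<inter> T)
      \<and> pairwise orthogonal_lines \<L>"
  proof (intro exI[of _ "range l"] conjI ballI)
    show "card (range l) = CARD('n)"
      using neq_l by (intro card_image injI) blast
    show "pairwise orthogonal_lines (range l)"
      unfolding pairwise_def using orth_l by (metis imageE)
    fix L assume "L \<in> range l"
    then show "straight_line L" "L \<subseteq> segments_M \<inter> T"
      using l_sub d_ne unfolding straight_line_def l_def by blast+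
  qed

  \<comment> \<open>Isometric copies of the punctured spaces\<close>
  have "card (UNIV - {o1}) = CARD('m)" using assms(2) by simp
  then obtain h where h: "bij_betw h (UNIV - {o1}) (UNIV :: 'm set)"
    by (metis finite finite_same_card_bij)
  define ext :: "real ^ 'm \<Rightarrow> (real, 'n) vec" where
    "ext y = (\<chi> j. if j = o1 then 0 else y $ h j)" for y
  have norm_ext: "norm (ext y) = norm y" for y
  proof -
    have "(\<Sum>j\<in>UNIV. (norm (ext y $ j))\<^sup>2) = (\<Sum>j\<in>UNIV - {o1}. (norm (y $ h j))\<^sup>2)"
      by (intro sum.mono_neutral_cong_right) (auto simp: ext_def)
    also have "\<dots> = (\<Sum>i\<in>UNIV. (norm (y $ i))\<^sup>2)"
      using h by (rule sum.reindex_bij_betw)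
    finally show ?thesis by (simp add: norm_vec_def L2_set_def)
  qed
  have iso_m: "\<exists>S\<subseteq>segments_M \<inter> T. isometric_sets S (UNIV - {0 :: real ^ 'm})"
  proof (rule isometric_punctured_spaceI)
    show "linear (\<lambda>y. cscale a (ext y))"
      by (rule linearI) (auto simp: vec_eq_iff ext_def scaleR_conv_of_real[where 'a=complex] algebra_simps)
    show "norm (cscale a (ext y)) = norm y" for y
      using a by (simp add: norm_cscale norm_ext)
    show "(\<lambda>y. cscale a (ext y)) ` (UNIV - {0}) \<subseteq> segments_M \<inter> T"
    proof (rule image_subsetI)
      fix y :: "real ^ 'm" assume "y \<in> UNIV - {0}"
      then have "ext y \<noteq> 0" using norm_ext[of y] by (metis DiffD2 norm_eq_zero singletonI)
      then show "cscale a (ext y) \<in> segments_M \<inter> T" by (intro realM) (simp_all add: ext_def)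
    qed
  qed

  \<comment> \<open>Multiplying the fixed vector \<open>x\<close> by a complex number scales lengths
    by \<open>norm x\<close>; the division makes the map norm-preserving.\<close>
  define g :: "real ^ 2 \<Rightarrow> (complex, 'n) vec" where
    "g c = cscale (Complex (c $ 1 / norm x) (c $ 2 / norm x) * a) x" for c
  have "\<exists>S\<subseteq>segments_M \<inter> T. isometric_sets S (UNIV - {0 :: real ^ 2})"
  proof (rule isometric_punctured_spaceI)
    show "linear g"
      by (rule linearI)
        (simp_all add: g_def vec_eq_iff Complex_eq scaleR_conv_of_real[where 'a=complex] add_divide_distrib algebra_simps)
    show "norm (g c) = norm c" for c
    proof -
      have "Complex (c $ 1 / norm x) (c $ 2 / norm x) = Complex (c $ 1) (c $ 2) / of_real (norm x)"
        by (simp add: complex_eq_iff)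
      then have "norm (g c) = norm (Complex (c $ 1) (c $ 2))"
        using x a by (simp add: g_def norm_cscale norm_mult norm_divide)
      then show ?thesis by (simp add: complex_norm norm_vec_def L2_set_def UNIV_2)
    qed
    show "g ` (UNIV - {0}) \<subseteq> segments_M \<inter> T"
    proof (rule image_subsetI)
      fix c :: "real ^ 2" assume "c \<in> UNIV - {0}"
      then have "c $ 1 \<noteq> 0 \<or> c $ 2 \<noteq> 0" by (auto simp: vec_eq_iff forall_2)
      then show "g c \<in> segments_M \<inter> T" unfolding g_def using x by (intro planeM) simp
    qed
  qed
  with aff lines iso_m show ?thesis unfolding T_def by blast
qed

end
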